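(* Let $\mathcal{X}$ denote the complex vector space $\ell_2(\mathbb{Z})$ equipped with the norm $$\|x\|_* = \max\Big\{\Big(\sum_{k \in \mathbb{Z}\setminus\{0,1\}} |x_k|^2\Big)^{1/2},\ |x_1|\Big\} + |x_0|, \qquad x = (x_k)_{k\in\mathbb{Z}}.$$ Then there exists a closed, densely defined linear operator $A : \mathcal{X} \to \mathcal{X}$ with a compact resolvent such that $\|(A-\lambda I)^{-1}\|$ is constant in a neighbourhood of $\lambda = 0$, i.e. there is an open neighbourhood of $0$ in $\mathbb{C}$ that is contained in the resolvent set of $A$ and on which the function $\lambda \mapsto \|(A-\lambda I)^{-1}\|$ is constant.
   Context: The norm $\|\cdot\|_*$ is equivalent to the usual norm of $\ell_2(\mathbb{Z})$, so $\mathcal{X}$ is a Banach space. The norm $\|(A-\lambda I)^{-1}\|$ is the operator norm on $\mathcal{X}$ induced by $\|\cdot\|_*$. A closed densely defined operator $A : \mathcal{X} \to \mathcal{X}$ means a (possibly unbounded) closed linear operator with dense domain in $\mathcal{X}$ and values in $\mathcal{X}$. It has a compact resolvent if its resolvent set is nonempty and $(A-\lambda I)^{-1}$ is a compact operator for every (equivalently, for some) $\lambda$ in the resolvent set. *)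

theory Defs
  imports "HOL-Analysis.Analysis"
begin

section \<open>Complex normed spaces\<close>

text \<open>
  The scalar multiplication by complex numbers extends the real one, so that the library's
  notions for \<^class>\<open>real_normed_vector\<close> (topology, \<^const>\<open>bounded_linear\<close>, \<^const>\<open>onorm\<close>) apply.
\<close>

class complex_normed_vector = real_normed_vector +
  fixes scaleC :: "complex \<Rightarrow> 'a \<Rightarrow> 'a"  (infixr "*\<^sub>C" 75)
  assumes scaleC_add_right: "a *\<^sub>C (x + y) = a *\<^sub>C x + a *\<^sub>C y"
    and scaleC_add_left: "(a + b) *\<^sub>C x = a *\<^sub>C x + b *\<^sub>C x"
    and scaleC_scaleC: "a *\<^sub>C (b *\<^sub>C x) = (a * b) *\<^sub>C x"
    and scaleC_one: "1 *\<^sub>C x = x"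
    and scaleR_scaleC: "r *\<^sub>R x = complex_of_real r *\<^sub>C x"
    and norm_scaleC: "norm (a *\<^sub>C x) = cmod a * norm x"

section \<open>Unbounded operators\<close>

text \<open>
  An operator \<open>A : X \<rightarrow> X\<close> is represented by its domain \<open>D\<close> and a total function \<open>A\<close>;
  none of the notions below depends on the values of \<open>A\<close> outside \<open>D\<close>.
\<close>

definition complex_subspace :: "'a::complex_normed_vector set \<Rightarrow> bool" where
  "complex_subspace D \<longleftrightarrow>
     0 \<in> D \<and> (\<forall>x\<in>D. \<forall>y\<in>D. x + y \<in> D) \<and> (\<forall>c. \<forall>x\<in>D. c *\<^sub>C x \<in> D)"

definition linear_operator ::
  "'a::complex_normed_vector set \<Rightarrow> ('a \<Rightarrow> 'a) \<Rightarrow> bool" where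
  "linear_operator D A \<longleftrightarrow>
     complex_subspace D \<and>
     (\<forall>x\<in>D. \<forall>y\<in>D. A (x + y) = A x + A y) \<and>
     (\<forall>c. \<forall>x\<in>D. A (c *\<^sub>C x) = c *\<^sub>C A x)"

definition closed_operator ::
  "'a::complex_normed_vector set \<Rightarrow> ('a \<Rightarrow> 'a) \<Rightarrow> bool" where
  "closed_operator D A \<longleftrightarrow> linear_operator D A \<and> closed {(x, A x) |x. x \<in> D}"

definition densely_defined :: "'a::complex_normed_vector set \<Rightarrow> bool" where
  "densely_defined D \<longleftrightarrow> closure D = UNIV"

text \<open>\<open>resolvent D A \<lambda>\<close> is \<open>(A - \<lambda>I)\<^sup>-\<^sup>1\<close>; it is meaningful only for \<open>\<lambda> \<in> resolvent_set D A\<close>.\<close>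

definition resolvent ::
  "'a::complex_normed_vector set \<Rightarrow> ('a \<Rightarrow> 'a) \<Rightarrow> complex \<Rightarrow> 'a \<Rightarrow> 'a" where
  "resolvent D A l = inv_into D (\<lambda>x. A x - l *\<^sub>C x)"

text \<open>
  For a linear operator the inverse is automatically complex linear, so that
  \<^const>\<open>bounded_linear\<close> only adds its boundedness.
\<close>

definition resolvent_set ::
  "'a::complex_normed_vector set \<Rightarrow> ('a \<Rightarrow> 'a) \<Rightarrow> complex set" where
  "resolvent_set D A =
     {l. bij_betw (\<lambda>x. A x - l *\<^sub>C x) D UNIV \<and> bounded_linear (resolvent D A l)}"

definition compact_operator ::
  "('a::complex_normed_vector \<Rightarrow> 'a) \<Rightarrow> bool" where
  "compact_operator T \<longleftrightarrow>
     bounded_linear T \<and> (\<forall>c x. T (c *\<^sub>C x) = c *\<^sub>C T x) \<and>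
     (\<forall>S. bounded S \<longrightarrow> compact (closure (T ` S)))"

definition has_compact_resolvent ::
  "'a::complex_normed_vector set \<Rightarrow> ('a \<Rightarrow> 'a) \<Rightarrow> bool" where
  "has_compact_resolvent D A \<longleftrightarrow>
     resolvent_set D A \<noteq> {} \<and> (\<forall>l\<in>resolvent_set D A. compact_operator (resolvent D A l))"

section \<open>Square summable families\<close>

definition square_summable :: "('i \<Rightarrow> complex) \<Rightarrow> bool" where
  "square_summable x \<longleftrightarrow> (\<lambda>k. (cmod (x k))\<^sup>2) summable_on UNIV"

definition l2_norm :: "'i set \<Rightarrow> ('i \<Rightarrow> complex) \<Rightarrow> real" where
  "l2_norm S x = sqrt (\<Sum>\<^sub>\<infinity>k\<in>S. (cmod (x k))\<^sup>2)"

lemma square_summable_on: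
  "square_summable x \<Longrightarrow> (\<lambda>k. (cmod (x k))\<^sup>2) summable_on S"
  unfolding square_summable_def by (rule summable_on_subset_banach) auto

lemma l2_norm_nonneg: "0 \<le> l2_norm S x"
  unfolding l2_norm_def by (simp add: infsum_nonneg)

lemma L2_set_le_l2_norm:
  assumes "square_summable x" "finite F" "F \<subseteq> S"
  shows "L2_set (\<lambda>k. cmod (x k)) F \<le> l2_norm S x"
  unfolding L2_set_def l2_norm_def
  by (intro real_sqrt_le_mono finite_sum_le_infsum square_summable_on assms) auto

lemma l2_bounded:
  assumes b: "\<And>F. finite F \<Longrightarrow> L2_set (\<lambda>k. cmod (x k)) F \<le> b"
  shows "square_summable x" "l2_norm S x \<le> b"
proof -
  have b0: "0 \<le> b"
    using b[of "{}"] by simp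
  have sq: "(\<Sum>k\<in>F. (cmod (x k))\<^sup>2) \<le> b\<^sup>2" if "finite F" for F
    using b[OF that] by (simp add: L2_set_def sqrt_le_D)
  show s: "square_summable x"
    unfolding square_summable_def
    by (rule nonneg_bdd_above_summable_on) (auto intro!: bdd_aboveI2[where M = "b\<^sup>2"] sq)
  have "(\<Sum>\<^sub>\<infinity>k\<in>S. (cmod (x k))\<^sup>2) \<le> b\<^sup>2"
    by (rule infsum_le_finite_sums[OF square_summable_on[OF s]]) (rule sq)
  then show "l2_norm S x \<le> b"
    unfolding l2_norm_def using b0 by (simp add: real_le_lsqrt)
qed

lemma L2_set_cmod_triangle:
  "L2_set (\<lambda>k. cmod (x k + y k)) F \<le> L2_set (\<lambda>k. cmod (x k)) F + L2_set (\<lambda>k. cmod (y k)) F"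
proof -
  have "L2_set (\<lambda>k. cmod (x k + y k)) F \<le> L2_set (\<lambda>k. cmod (x k) + cmod (y k)) F"
    by (rule L2_set_mono) (auto intro: norm_triangle_ineq)
  also have "\<dots> \<le> L2_set (\<lambda>k. cmod (x k)) F + L2_set (\<lambda>k. cmod (y k)) F"
    by (rule L2_set_triangle_ineq)
  finally show ?thesis .
qed

lemma square_summable_zero: "square_summable (\<lambda>_. 0)"
  by (simp add: square_summable_def)

lemma square_summable_add:
  assumes "square_summable x" "square_summable y"
  shows "square_summable (\<lambda>k. x k + y k)"
proof (rule l2_bounded(1))
  fix F :: "'a set" assume "finite F"
  then show "L2_set (\<lambda>k. cmod (x k + y k)) F \<le> l2_norm UNIV x + l2_norm UNIV y"
    using L2_set_cmod_triangle[of x y F] L2_set_le_l2_norm[OF assms(1), of F UNIV]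
      L2_set_le_l2_norm[OF assms(2), of F UNIV] by simp
qed

lemma square_summable_mult:
  "square_summable x \<Longrightarrow> square_summable (\<lambda>k. c * x k)"
  by (simp add: square_summable_def norm_mult power_mult_distrib summable_on_cmult_right)

lemma l2_norm_mult: "l2_norm S (\<lambda>k. c * x k) = cmod c * l2_norm S x"
  by (simp add: l2_norm_def norm_mult power_mult_distrib infsum_cmult_right' real_sqrt_mult)

lemma l2_norm_triangle:
  assumes "square_summable x" "square_summable y"
  shows "l2_norm S (\<lambda>k. x k + y k) \<le> l2_norm S x + l2_norm S y"
proof -
  have "(\<Sum>k\<in>F. (cmod (x k + y k))\<^sup>2) \<le> (l2_norm S x + l2_norm S y)\<^sup>2"
    if "finite F" "F \<subseteq> S" for F
  proof -
    have "L2_set (\<lambda>k. cmod (x k + y k)) F \<le> l2_norm S x + l2_norm S y"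
      using L2_set_cmod_triangle[of x y F] L2_set_le_l2_norm[OF assms(1) that]
        L2_set_le_l2_norm[OF assms(2) that] by simp
    then show ?thesis
      by (simp add: L2_set_def sqrt_le_D)
  qed
  then have "(\<Sum>\<^sub>\<infinity>k\<in>S. (cmod (x k + y k))\<^sup>2) \<le> (l2_norm S x + l2_norm S y)\<^sup>2"
    by (intro infsum_le_finite_sums square_summable_on square_summable_add assms) auto
  then show ?thesis
    by (simp add: l2_norm_def[of S "\<lambda>k. x k + y k"] l2_norm_nonneg real_le_lsqrt)
qed

lemma l2_norm_zero: "l2_norm S (\<lambda>_. 0) = 0"
  by (simp add: l2_norm_def)

lemma cmod_le_l2_norm:
  assumes "square_summable x" "k \<in> S"
  shows "cmod (x k) \<le> l2_norm S x"
  using L2_set_le_l2_norm[of x "{k}" S] assms by simp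

section \<open>The space \<open>\<ell>\<^sub>2(\<int>)\<close> with the norm \<open>\<parallel>\<cdot>\<parallel>\<^sub>*\<close>\<close>

typedef ell2_star = "{x :: int \<Rightarrow> complex. square_summable x}"
  morphisms coord Abs_ell2_star
  using square_summable_zero by blast

setup_lifting type_definition_ell2_star

lemma square_summable_coord: "square_summable (coord x)"
  using coord by auto

instantiation ell2_star :: complex_normed_vector
begin

lift_definition zero_ell2_star :: ell2_star is "\<lambda>_. 0"
  by (rule square_summable_zero)

lift_definition plus_ell2_star :: "ell2_star \<Rightarrow> ell2_star \<Rightarrow> ell2_star"
  is "\<lambda>x y k. x k + y k"
  by (rule square_summable_add)

lift_definition uminus_ell2_star :: "ell2_star \<Rightarrow> ell2_star" is "\<lambda>x k. - x k"
  by (simp add: square_summable_def)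

lift_definition minus_ell2_star :: "ell2_star \<Rightarrow> ell2_star \<Rightarrow> ell2_star"
  is "\<lambda>x y k. x k - y k"
  subgoal for x y
    using square_summable_add[of x "\<lambda>k. - y k"] by (simp add: square_summable_def)
  done

lift_definition scaleC_ell2_star :: "complex \<Rightarrow> ell2_star \<Rightarrow> ell2_star"
  is "\<lambda>c x k. c * x k"
  by (rule square_summable_mult)

definition scaleR_ell2_star :: "real \<Rightarrow> ell2_star \<Rightarrow> ell2_star" where
  "scaleR_ell2_star r x = complex_of_real r *\<^sub>C x"

definition norm_ell2_star :: "ell2_star \<Rightarrow> real" where
  "norm_ell2_star x =
     max (l2_norm (UNIV - {0, 1}) (coord x)) (cmod (coord x 1)) + cmod (coord x 0)"

definition dist_ell2_star :: "ell2_star \<Rightarrow> ell2_star \<Rightarrow> real" where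
  "dist_ell2_star x y = norm (x - y)"

definition sgn_ell2_star :: "ell2_star \<Rightarrow> ell2_star" where
  "sgn_ell2_star x = inverse (norm x) *\<^sub>R x"

definition uniformity_ell2_star :: "(ell2_star \<times> ell2_star) filter" where
  "uniformity_ell2_star = (INF e\<in>{0 <..}. principal {(x, y). dist x y < e})"

definition open_ell2_star :: "ell2_star set \<Rightarrow> bool" where
  "open_ell2_star U \<longleftrightarrow> (\<forall>x\<in>U. eventually (\<lambda>(x', y). x' = x \<longrightarrow> y \<in> U) uniformity)"

instance
proof
  fix x y z :: ell2_star and a b :: complex and r s :: real and U :: "ell2_star set"
  show "x + y + z = x + (y + z)" "x + y = y + x" "0 + x = x" "- x + x = 0" "x - y = x + - y"
    by (transfer; auto)+
  show c1: "a *\<^sub>C (x + y) = a *\<^sub>C x + a *\<^sub>C y"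
    by transfer (simp add: algebra_simps)
  show c2: "(a + b) *\<^sub>C x = a *\<^sub>C x + b *\<^sub>C x"
    by transfer (simp add: algebra_simps)
  show c3: "a *\<^sub>C (b *\<^sub>C x) = (a * b) *\<^sub>C x"
    by transfer (simp add: algebra_simps)
  show c4: "1 *\<^sub>C x = x"
    by transfer simp
  show "r *\<^sub>R x = complex_of_real r *\<^sub>C x"
    by (rule scaleR_ell2_star_def)
  show "r *\<^sub>R (x + y) = r *\<^sub>R x + r *\<^sub>R y"
    unfolding scaleR_ell2_star_def by transfer (simp add: algebra_simps)
  show "(r + s) *\<^sub>R x = r *\<^sub>R x + s *\<^sub>R x"
    unfolding scaleR_ell2_star_def by transfer (simp add: algebra_simps)
  show "r *\<^sub>R s *\<^sub>R x = (r * s) *\<^sub>R x"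
    unfolding scaleR_ell2_star_def by transfer (simp add: algebra_simps)
  show "1 *\<^sub>R x = x"
    unfolding scaleR_ell2_star_def by transfer simp
  show n: "norm (a *\<^sub>C x) = cmod a * norm x" for a
    by (simp add: norm_ell2_star_def scaleC_ell2_star.rep_eq l2_norm_mult norm_mult
        distrib_left max_mult_distrib_left)
  show "norm (r *\<^sub>R x) = \<bar>r\<bar> * norm x"
    by (simp add: scaleR_ell2_star_def n)
  show "norm (x + y) \<le> norm x + norm y"
    using l2_norm_triangle[OF square_summable_coord square_summable_coord,
        of "UNIV - {0, 1}" x y]
      norm_triangle_ineq[of "coord x 1" "coord y 1"] norm_triangle_ineq[of "coord x 0" "coord y 0"]
    unfolding norm_ell2_star_def plus_ell2_star.rep_eq by linarith
  show "norm x = 0 \<longleftrightarrow> x = 0"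
  proof
    assume "norm x = 0"
    then have *: "l2_norm (UNIV - {0, 1}) (coord x) = 0" "cmod (coord x 1) = 0"
        "cmod (coord x 0) = 0"
      using l2_norm_nonneg[of "UNIV - {0, 1}" "coord x"] norm_ge_zero[of "coord x 1"]
        norm_ge_zero[of "coord x 0"]
      unfolding norm_ell2_star_def by linarith+
    have "coord x k = 0" for k
      using cmod_le_l2_norm[OF square_summable_coord, of k "UNIV - {0, 1}" x] *
      by (cases "k = 0 \<or> k = 1") auto
    then show "x = 0"
      by (simp add: coord_inject[symmetric] zero_ell2_star.rep_eq fun_eq_iff)
  next
    assume "x = 0"
    then show "norm x = 0"
      by (simp add: norm_ell2_star_def zero_ell2_star.rep_eq l2_norm_zero)
  qed
qed (rule dist_ell2_star_def sgn_ell2_star_def uniformity_ell2_star_def open_ell2_star_def)+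

end

text \<open>Equivalence of \<open>\<parallel>\<cdot>\<parallel>\<^sub>*\<close> with the usual norm, and completeness.\<close>

lemma norm_ell2_star_ge:
  "l2_norm (UNIV - {0, 1}) (coord x) + cmod (coord x 0) \<le> norm x"
  "cmod (coord x 1) + cmod (coord x 0) \<le> norm x"
  unfolding norm_ell2_star_def by auto

lemma norm_le_l2_norm: "norm x \<le> 2 * l2_norm UNIV (coord x)"
proof -
  have "l2_norm (UNIV - {0, 1}) (coord x) \<le> l2_norm UNIV (coord x)"
    unfolding l2_norm_def
    by (intro real_sqrt_le_mono infsum_mono2 square_summable_on square_summable_coord) auto
  then show ?thesis
    using cmod_le_l2_norm[OF square_summable_coord, of 0 UNIV x]
      cmod_le_l2_norm[OF square_summable_coord, of 1 UNIV x]
    unfolding norm_ell2_star_def by simp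
qed

lemma l2_norm_le_norm: "l2_norm UNIV (coord x) \<le> 2 * norm x"
proof -
  let ?f = "\<lambda>k. (cmod (coord x k))\<^sup>2" and ?S = "UNIV - {0, 1} :: int set"
  have s: "?f summable_on S" for S
    by (intro square_summable_on square_summable_coord)
  have "infsum ?f UNIV = infsum ?f (?S \<union> {0, 1})"
    by (rule arg_cong[where f = "infsum ?f"]) auto
  also have "\<dots> = infsum ?f ?S + (?f 0 + ?f 1)"
    by (subst infsum_Un_disjoint) (auto intro: s)
  finally have eq: "l2_norm UNIV (coord x) = sqrt (infsum ?f ?S + (?f 0 + ?f 1))"
    by (simp add: l2_norm_def)
  have 0: "0 \<le> infsum ?f ?S"
    by (simp add: infsum_nonneg)
  have "l2_norm UNIV (coord x) \<le> sqrt (infsum ?f ?S) + sqrt (?f 0 + ?f 1)"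
    unfolding eq by (rule sqrt_add_le_add_sqrt) (use 0 in auto)
  also have "\<dots> \<le> l2_norm ?S (coord x) + (cmod (coord x 0) + cmod (coord x 1))"
    using sqrt_add_le_add_sqrt[of "?f 0" "?f 1"] by (simp add: l2_norm_def)
  also have "\<dots> \<le> 2 * norm x"
    using norm_ell2_star_ge[of x] norm_ge_zero[of "coord x 0"] by linarith
  finally show ?thesis .
qed

lemma cmod_coord_le_norm: "cmod (coord x k) \<le> norm x"
proof -
  have "cmod (coord x k) \<le> l2_norm (UNIV - {0, 1}) (coord x)" if "k \<noteq> 0" "k \<noteq> 1"
    using that by (intro cmod_le_l2_norm square_summable_coord) auto
  then consider "cmod (coord x k) = cmod (coord x 0)" | "cmod (coord x k) = cmod (coord x 1)"
    | "cmod (coord x k) \<le> l2_norm (UNIV - {0, 1}) (coord x)"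
    by blast
  then show ?thesis
    using norm_ell2_star_ge[of x] norm_ge_zero[of "coord x 0"] norm_ge_zero[of "coord x 1"]
    by cases linarith+
qed

instance ell2_star :: banach
proof
  fix X :: "nat \<Rightarrow> ell2_star"
  assume X: "Cauchy X"
  have "Cauchy (\<lambda>n. coord (X n) k)" for k
  proof (rule metric_CauchyI)
    fix e :: real assume "0 < e"
    then obtain M where M: "\<And>m n. m \<ge> M \<Longrightarrow> n \<ge> M \<Longrightarrow> dist (X m) (X n) < e"
      using X by (meson metric_CauchyD)
    have "dist (coord (X m) k) (coord (X n) k) \<le> dist (X m) (X n)" for m n
      using cmod_coord_le_norm[of "X m - X n" k]
      by (simp add: dist_norm minus_ell2_star.rep_eq)
    then show "\<exists>M. \<forall>m\<ge>M. \<forall>n\<ge>M. dist (coord (X m) k) (coord (X n) k) < e"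
      using M by (meson le_less_trans)
  qed
  then obtain z where z: "\<And>k. (\<lambda>n. coord (X n) k) \<longlonglongrightarrow> z k"
    unfolding Cauchy_convergent_iff convergent_def by metis
  have close: "L2_set (\<lambda>k. cmod (z k - coord (X n) k)) F \<le> 2 * e"
    if M: "\<And>m n. m \<ge> M \<Longrightarrow> n \<ge> M \<Longrightarrow> dist (X m) (X n) < e" and "n \<ge> M" "finite F" for M n e F
  proof (rule tendsto_upperbound)
    show "(\<lambda>m. L2_set (\<lambda>k. cmod (coord (X m) k - coord (X n) k)) F)
        \<longlonglongrightarrow> L2_set (\<lambda>k. cmod (z k - coord (X n) k)) F"
      unfolding L2_set_def by (intro tendsto_intros z)
    show "\<forall>\<^sub>F m in sequentially. L2_set (\<lambda>k. cmod (coord (X m) k - coord (X n) k)) F \<le> 2 * e"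
    proof (rule eventually_sequentiallyI)
      fix m assume "M \<le> m"
      have "L2_set (\<lambda>k. cmod (coord (X m) k - coord (X n) k)) F \<le> l2_norm UNIV (coord (X m - X n))"
        using L2_set_le_l2_norm[OF square_summable_coord \<open>finite F\<close>, of UNIV "X m - X n"]
        by (simp add: minus_ell2_star.rep_eq)
      also have "\<dots> \<le> 2 * norm (X m - X n)"
        by (rule l2_norm_le_norm)
      also have "\<dots> \<le> 2 * e"
        using M[OF \<open>M \<le> m\<close> \<open>n \<ge> M\<close>] by (simp add: dist_norm)
      finally show "L2_set (\<lambda>k. cmod (coord (X m) k - coord (X n) k)) F \<le> 2 * e" .
    qed
  qed simp
  obtain M where M: "\<And>m n. m \<ge> M \<Longrightarrow> n \<ge> M \<Longrightarrow> dist (X m) (X n) < 1"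
    using X by (meson metric_CauchyD zero_less_one)
  have "square_summable (\<lambda>k. z k - coord (X M) k)"
    by (rule l2_bounded(1)[where b = "2 * 1"]) (rule close[OF M order.refl])
  then have "square_summable (\<lambda>k. (z k - coord (X M) k) + coord (X M) k)"
    by (rule square_summable_add[OF _ square_summable_coord])
  then have zs: "coord (Abs_ell2_star z) = z"
    by (simp add: Abs_ell2_star_inverse)
  have "X \<longlonglongrightarrow> Abs_ell2_star z"
  proof (rule metric_LIMSEQ_I)
    fix e :: real assume "0 < e"
    then obtain M where M: "\<And>m n. m \<ge> M \<Longrightarrow> n \<ge> M \<Longrightarrow> dist (X m) (X n) < e / 8"
      using X by (metis metric_CauchyD zero_less_divide_iff zero_less_numeral)
    have "dist (X n) (Abs_ell2_star z) < e" if "n \<ge> M" for n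
    proof -
      have "dist (X n) (Abs_ell2_star z) = norm (Abs_ell2_star z - X n)"
        by (simp add: dist_norm norm_minus_commute)
      also have "\<dots> \<le> 2 * l2_norm UNIV (\<lambda>k. z k - coord (X n) k)"
        using norm_le_l2_norm[of "Abs_ell2_star z - X n"]
        by (simp add: minus_ell2_star.rep_eq zs)
      also have "l2_norm UNIV (\<lambda>k. z k - coord (X n) k) \<le> 2 * (e / 8)"
        by (rule l2_bounded(2)) (rule close[OF M that])
      finally show ?thesis
        using \<open>0 < e\<close> by simp
    qed
    then show "\<exists>M. \<forall>n\<ge>M. dist (X n) (Abs_ell2_star z) < e"
      by blast
  qed
  then show "convergent X"
    by (rule convergentI)
qed

end

theory Submission
  imports Defs
begin

text \<open>
  Let \<open>K\<close> be the weighted shift \<open>K e\<^sub>k = w\<^sub>k e\<^sub>k\<^sub>+\<^sub>1\<close> with \<open>w\<^sub>0 = 1\<close> and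
  \<open>w\<^sub>k = 1 / (8\<bar>k\<bar>)\<close> otherwise. It is compact, injective and has dense range, so \<open>A = K\<^sup>-\<^sup>1\<close>
  is closed and densely defined and has a compact resolvent \<open>R(\<lambda>) = K + \<lambda>K\<^sup>2 + \<dots>\<close>.
  Since \<open>R(\<lambda>) e\<^sub>0 = e\<^sub>1 + \<lambda> w\<^sub>1 e\<^sub>2 + \<dots>\<close>, the maximum in the norm makes \<open>\<parallel>R(\<lambda>) e\<^sub>0\<parallel> = 1\<close>
  for small \<open>\<lambda>\<close>. On vectors \<open>y\<close> with \<open>y\<^sub>0 = 0\<close> the norm of \<open>K\<close> is at most \<open>1/2\<close>, hence
  that of \<open>R(\<lambda>)\<close> is at most \<open>1\<close>. As \<open>\<parallel>x\<parallel>\<close> is the sum of \<open>\<bar>x\<^sub>0\<bar>\<close> and the norm of the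
  remaining part, \<open>\<parallel>R(\<lambda>)\<parallel> = 1\<close>.
\<close>

section \<open>Operators with a compact inverse\<close>

lemma bounded_linear_scaleC_left:
  "bounded_linear (\<lambda>c. c *\<^sub>C (v :: 'a :: complex_normed_vector))"
proof (rule bounded_linear_intro)
  fix c d :: complex and r :: real
  show "(c + d) *\<^sub>C v = c *\<^sub>C v + d *\<^sub>C v"
    by (rule scaleC_add_left)
  show "(r *\<^sub>R c) *\<^sub>C v = r *\<^sub>R c *\<^sub>C v"
    by (simp add: scaleR_scaleC scaleC_scaleC scaleR_conv_of_real)
  show "norm (c *\<^sub>C v) \<le> norm c * norm v"
    by (simp add: norm_scaleC)
qed

lemma bounded_linear_scaleC_right:
  "bounded_linear (\<lambda>v. c *\<^sub>C (v :: 'a :: complex_normed_vector))"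
proof (rule bounded_linear_intro)
  fix v w :: 'a and r :: real
  show "c *\<^sub>C (v + w) = c *\<^sub>C v + c *\<^sub>C w"
    by (rule scaleC_add_right)
  show "c *\<^sub>C (r *\<^sub>R v) = r *\<^sub>R c *\<^sub>C v"
    by (simp add: scaleR_scaleC scaleC_scaleC mult.commute)
  show "norm (c *\<^sub>C v) \<le> norm v * norm c"
    by (simp add: norm_scaleC)
qed

text \<open>In a complete space it suffices that the closure is totally bounded. An
  \<open>e / 3\<close>-net of the compact set \<open>C\<close> becomes an \<open>e\<close>-net of
  \<open>closure T\<close>: one third is spent on leaving the closure, one on reaching
  \<open>C\<close>, one on reaching the net.\<close>

lemma compact_closure_if_approx:
  fixes T :: "'a :: {real_normed_vector, banach} set"
  assumes approx: "\<And>e. e > 0 \<Longrightarrow> \<exists>C. compact C \<and> (\<forall>x\<in>T. \<exists>y\<in>C. dist x y < e)"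
  shows "compact (closure T)"
  unfolding compact_eq_totally_bounded
proof (intro conjI allI impI)
  show "complete (closure T)"
    by (simp add: complete_eq_closed)
next
  fix e :: real assume "e > 0"
  then obtain C where C: "compact C" "\<forall>x\<in>T. \<exists>y\<in>C. dist x y < e / 3"
    using approx[of "e / 3"] by auto
  obtain k where k: "finite k" "C \<subseteq> (\<Union>x\<in>k. ball x (e / 3))"
    using C(1) \<open>e > 0\<close> unfolding compact_eq_totally_bounded
    by (meson divide_pos_pos zero_less_numeral)
  have "closure T \<subseteq> (\<Union>x\<in>k. ball x e)"
  proof
    fix x assume "x \<in> closure T"
    then obtain t where t: "t \<in> T" "dist t x < e / 3"
      using \<open>e > 0\<close> by (metis closure_approachable divide_pos_pos zero_less_numeral)
    then obtain y where y: "y \<in> C" "dist t y < e / 3"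
      using C(2) by auto
    then obtain z where z: "z \<in> k" "dist z y < e / 3"
      using k(2) by auto
    have "dist z x < e"
      using t(2) y(2) z(2) dist_triangle[of z x y] dist_triangle3[of y x t] by linarith
    then show "x \<in> (\<Union>x\<in>k. ball x e)"
      using z(1) by auto
  qed
  then show "\<exists>k. finite k \<and> closure T \<subseteq> (\<Union>x\<in>k. ball x e)"
    using k(1) by blast
qed

text \<open>The unbounded operator is \<open>inv K\<close> with domain \<open>range K\<close>.
  Substituting \<open>x = K z\<close> turns every question about \<open>A - lI\<close> into one
  about the everywhere defined map \<open>I - lK\<close>.\<close>

locale compact_inverse =
  fixes K :: "'a :: {complex_normed_vector, banach} \<Rightarrow> 'a"
  assumes compact: "compact_operator K" and inj: "inj K"
begin

lemma linear: "bounded_linear K" and scaleC: "K (c *\<^sub>C x) = c *\<^sub>C K x"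
  using compact by (auto simp: compact_operator_def)

lemma add: "K (x + y) = K x + K y"
  by (rule linear_add[OF bounded_linear.linear[OF linear]])

lemma diff: "K (x - y) = K x - K y"
  by (rule linear_diff[OF bounded_linear.linear[OF linear]])

lemma inv_K [simp]: "inv K (K x) = x"
  by (rule inv_f_f[OF inj])

text \<open>The graph of the inverse is the graph of the continuous map \<open>K\<close> with its
  two components swapped.\<close>

lemma closed_operator_inverse: "closed_operator (range K) (inv K)"
proof -
  have "K 0 = 0"
    by (rule linear_0[OF bounded_linear.linear[OF linear]])
  then have "complex_subspace (range K)"
    unfolding complex_subspace_def by (auto simp flip: add scaleC)
  moreover have "{(x, inv K x) |x. x \<in> range K} = {p. fst p = K (snd p)}"
    by auto
  moreover have "closed {p. fst p = K (snd p)}"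
    by (intro closed_Collect_eq continuous_intros bounded_linear.continuous_on[OF linear])
  ultimately show ?thesis
    unfolding closed_operator_def linear_operator_def by (auto simp flip: add scaleC)
qed

lemma bij_betw_inverse_minus:
  "bij_betw (\<lambda>x. inv K x - l *\<^sub>C x) (range K) UNIV \<longleftrightarrow> bij (\<lambda>z. z - l *\<^sub>C K z)"
proof -
  have "bij_betw K UNIV (range K)"
    by (simp add: bij_betw_def inj)
  from bij_betw_comp_iff[OF this, of "\<lambda>x. inv K x - l *\<^sub>C x" UNIV] show ?thesis
    by (simp add: comp_def)
qed

text \<open>This is how resolvent values are computed: if \<open>z\<close> solves
  \<open>z = y + l *\<^sub>C K z\<close>, then \<open>A - lI\<close> sends \<open>K z\<close> to
  \<open>z - l *\<^sub>C K z = y\<close>.\<close>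

lemma resolvent_eq:
  assumes "bij (\<lambda>z. z - l *\<^sub>C K z)" "z = y + l *\<^sub>C K z"
  shows "resolvent (range K) (inv K) l y = K z"
proof -
  have "inj_on (\<lambda>x. inv K x - l *\<^sub>C x) (range K)"
    using assms(1) bij_betw_imp_inj_on bij_betw_inverse_minus by blast
  moreover have "y = inv K (K z) - l *\<^sub>C K z"
    using assms(2) by (simp add: algebra_simps)
  ultimately show ?thesis
    unfolding resolvent_def by (auto intro: inv_into_f_eq)
qed

text \<open>The identity \<open>R = K (I + lR)\<close>, through which the resolvent inherits
  linearity and compactness from \<open>K\<close>.\<close>

lemma resolvent_fixed_point:
  assumes "bij (\<lambda>z. z - l *\<^sub>C K z)"
  shows "resolvent (range K) (inv K) l y = K (y + l *\<^sub>C resolvent (range K) (inv K) l y)"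
proof -
  obtain z where "y = z - l *\<^sub>C K z"
    using bij_is_surj[OF assms] by (rule surjE)
  then have z: "z = y + l *\<^sub>C K z"
    by simp
  show ?thesis
    unfolding resolvent_eq[OF assms z] by (rule arg_cong[OF z])
qed

lemma resolvent_scaleC:
  assumes "bij (\<lambda>z. z - l *\<^sub>C K z)"
  shows "resolvent (range K) (inv K) l (c *\<^sub>C y) = c *\<^sub>C resolvent (range K) (inv K) l y"
proof -
  let ?z = "y + l *\<^sub>C resolvent (range K) (inv K) l y"
  have "c *\<^sub>C ?z = c *\<^sub>C y + l *\<^sub>C K (c *\<^sub>C ?z)"
    by (subst scaleC, subst resolvent_fixed_point[OF assms, symmetric])
      (simp add: scaleC_add_right scaleC_scaleC mult.commute)
  from resolvent_eq[OF assms this] show ?thesis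
    by (simp add: scaleC flip: resolvent_fixed_point[OF assms])
qed

lemma resolvent_add:
  assumes "bij (\<lambda>z. z - l *\<^sub>C K z)"
  shows "resolvent (range K) (inv K) l (x + y) =
    resolvent (range K) (inv K) l x + resolvent (range K) (inv K) l y"
proof -
  let ?R = "resolvent (range K) (inv K) l"
  let ?z = "(x + l *\<^sub>C ?R x) + (y + l *\<^sub>C ?R y)"
  have "K ?z = K (x + l *\<^sub>C ?R x) + K (y + l *\<^sub>C ?R y)"
    by (rule add)
  also have "\<dots> = ?R x + ?R y"
    by (intro arg_cong2[where f = plus] resolvent_fixed_point[OF assms, symmetric])
  finally have K: "K ?z = ?R x + ?R y" .
  then have "?z = x + y + l *\<^sub>C K ?z"
    by (simp add: scaleC_add_right algebra_simps)
  from resolvent_eq[OF assms this] K show ?thesis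
    by simp
qed

text \<open>By \<open>R = K (I + lR)\<close>, the resolvent is a bounded map followed by a compact
  one. This covers every resolvent point, not only small \<open>l\<close>.\<close>

lemma compact_resolvent:
  assumes "l \<in> resolvent_set (range K) (inv K)"
  shows "compact_operator (resolvent (range K) (inv K) l)" (is "compact_operator ?R")
  unfolding compact_operator_def
proof (intro conjI allI impI)
  have bij: "bij (\<lambda>z. z - l *\<^sub>C K z)"
    using assms by (simp add: resolvent_set_def bij_betw_inverse_minus)
  show R: "bounded_linear ?R"
    using assms by (simp add: resolvent_set_def)
  show "?R (c *\<^sub>C x) = c *\<^sub>C ?R x" for c x
    by (rule resolvent_scaleC[OF bij])
  fix S :: "'a set" assume "bounded S"
  moreover have "bounded_linear (\<lambda>y. y + l *\<^sub>C ?R y)"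
    by (intro bounded_linear_add bounded_linear_ident
        bounded_linear_compose[OF bounded_linear_scaleC_right R])
  ultimately have "bounded ((\<lambda>y. y + l *\<^sub>C ?R y) ` S)"
    by (rule bounded_linear_image)
  then have "compact (closure (K ` (\<lambda>y. y + l *\<^sub>C ?R y) ` S))"
    using compact by (simp add: compact_operator_def)
  moreover have "K ` (\<lambda>y. y + l *\<^sub>C ?R y) ` S = ?R ` S"
    by (simp add: image_image flip: resolvent_fixed_point[OF bij])
  ultimately show "compact (closure (?R ` S))"
    by simp
qed

section \<open>Small spectral parameters, where \<open>lK\<close> is a contraction\<close>

context
  fixes l :: complex and B :: real
  assumes bound: "\<And>x. norm (K x) \<le> B * norm x" and small: "cmod l * B \<le> 1 / 2"
begin

lemma norm_scaleC_K_le: "norm (l *\<^sub>C K x) \<le> norm x / 2"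
proof -
  have "norm (l *\<^sub>C K x) \<le> cmod l * B * norm x"
    using mult_left_mono[OF bound[of x] norm_ge_zero[of l]] by (simp add: norm_scaleC)
  also have "\<dots> \<le> 1 / 2 * norm x"
    by (rule mult_right_mono[OF small]) simp
  finally show ?thesis
    by simp
qed

text \<open>The term \<open>l *\<^sub>C K z\<close> has at most half the norm of \<open>z\<close>
  and is absorbed into the left-hand side.\<close>

lemma norm_solution_le:
  assumes "z = y + l *\<^sub>C K z"
  shows "norm z \<le> 2 * norm y"
  using norm_triangle_ineq[of y "l *\<^sub>C K z"] norm_scaleC_K_le[of z] assms by simp

text \<open>Banach's fixed point theorem for \<open>z \<mapsto> y + l *\<^sub>C K z\<close>, which
  contracts by the factor \<open>1 / 2\<close>, replaces the Neumann series.\<close>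

lemma bij_id_minus: "bij (\<lambda>z. z - l *\<^sub>C K z)"
proof -
  have "\<exists>!z. y + l *\<^sub>C K z = z" for y
  proof (rule banach_fix_type)
    have "(y + l *\<^sub>C K x) - (y + l *\<^sub>C K z) = l *\<^sub>C K (x - z)" for x z
      by (simp add: diff linear_diff[OF bounded_linear.linear[OF bounded_linear_scaleC_right]])
    then show "\<forall>x z. dist (y + l *\<^sub>C K x) (y + l *\<^sub>C K z) \<le> 1 / 2 * dist x z"
      using norm_scaleC_K_le by (simp add: dist_norm)
  qed auto
  then have "\<exists>!z. z - l *\<^sub>C K z = y" for y
    by (simp add: diff_eq_eq eq_commute[of _ "_ + _"])
  then show ?thesis
    unfolding bij_def inj_def surj_def by metis
qed

lemma in_resolvent_set: "l \<in> resolvent_set (range K) (inv K)"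
proof -
  let ?R = "resolvent (range K) (inv K) l"
  have "bounded_linear ?R"
  proof (rule bounded_linear_intro)
    show "?R (x + y) = ?R x + ?R y" for x y
      by (rule resolvent_add[OF bij_id_minus])
    show "?R (r *\<^sub>R x) = r *\<^sub>R ?R x" for r x
      by (simp add: scaleR_scaleC resolvent_scaleC[OF bij_id_minus])
    \<comment> \<open>The sign of \<open>B\<close> is not fixed by the hypotheses, hence the
      absolute value.\<close>
    show "norm (?R y) \<le> norm y * (\<bar>B\<bar> * 2)" for y
    proof -
      let ?z = "y + l *\<^sub>C ?R y"
      have R: "?R y = K ?z"
        by (rule resolvent_fixed_point[OF bij_id_minus])
      then have "norm ?z \<le> 2 * norm y"
        by (intro norm_solution_le) simp
      then have "\<bar>B\<bar> * norm ?z \<le> \<bar>B\<bar> * (2 * norm y)"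
        by (rule mult_left_mono) simp
      moreover have "B * norm ?z \<le> \<bar>B\<bar> * norm ?z"
        by (rule mult_right_mono) auto
      ultimately show ?thesis
        using bound[of ?z] R by (simp add: mult_ac)
    qed
  qed
  then show ?thesis
    by (simp add: resolvent_set_def bij_betw_inverse_minus bij_id_minus)
qed

end

lemma has_compact_resolvent_inverse: "has_compact_resolvent (range K) (inv K)"
proof -
  obtain B where "\<And>x. norm (K x) \<le> B * norm x"
    using bounded_linear.bounded[OF linear] by (metis mult.commute)
  \<comment> \<open>At \<open>l = 0\<close> the smallness condition holds whatever \<open>B\<close>
    is, so the resolvent set is nonempty.\<close>
  from in_resolvent_set[OF this, of 0] show ?thesis
    unfolding has_compact_resolvent_def by (auto intro: compact_resolvent)
qed

end

section \<open>Unit vectors and truncation\<close>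

lift_definition unit_vec :: "int \<Rightarrow> ell2_star" is "\<lambda>i k. if k = i then 1 else 0"
  unfolding square_summable_def
  by (rule finite_nonzero_values_imp_summable_on) (auto simp: if_distrib cong: if_cong)

lemma coord_add: "coord (x + y) k = coord x k + coord y k"
  by (simp add: plus_ell2_star.rep_eq)

lemma coord_diff: "coord (x - y) k = coord x k - coord y k"
  by (simp add: minus_ell2_star.rep_eq)

lemma coord_scaleC: "coord (c *\<^sub>C x) k = c * coord x k"
  by (simp add: scaleC_ell2_star.rep_eq)

lemma coord_unit_vec: "coord (unit_vec i) k = (if k = i then 1 else 0)"
  by (simp add: unit_vec.rep_eq)

lemma coord_sum: "coord (\<Sum>i\<in>F. f i) k = (\<Sum>i\<in>F. coord (f i) k)"
  by (induction F rule: infinite_finite_induct)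
    (auto simp: coord_add zero_ell2_star.rep_eq)

lemma ell2_star_eqI: "(\<And>k. coord x k = coord y k) \<Longrightarrow> x = y"
  by (simp add: coord_inject[symmetric] fun_eq_iff)

definition truncate :: "int set \<Rightarrow> ell2_star \<Rightarrow> ell2_star" where
  "truncate F x = (\<Sum>k\<in>F. coord x k *\<^sub>C unit_vec k)"

lemma coord_truncate:
  "finite F \<Longrightarrow> coord (truncate F x) k = (if k \<in> F then coord x k else 0)"
  by (auto simp: truncate_def coord_sum coord_scaleC coord_unit_vec if_distrib
      cong: if_cong)

lemma truncate_approx:
  assumes "e > 0"
  shows "\<exists>F. finite F \<and> norm (x - truncate F x) < e"
proof -
  let ?f = "\<lambda>k. (cmod (coord x k))\<^sup>2"
  have s: "?f summable_on S" for S
    by (intro square_summable_on square_summable_coord)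
  \<comment> \<open>A tail of usual norm at most \<open>e / 3\<close> has new norm at most
    \<open>2 * e / 3\<close>, which is below \<open>e\<close>.\<close>
  have "(e / 3)\<^sup>2 > 0"
    using assms by simp
  with infsum_finite_approximation[OF s[of UNIV]] obtain F
    where F: "finite F" "dist (sum ?f F) (infsum ?f UNIV) \<le> (e / 3)\<^sup>2"
    by blast
  have "L2_set (\<lambda>k. cmod (coord (x - truncate F x) k)) G \<le> e / 3" if "finite G" for G
  proof -
    have "(\<Sum>k\<in>G. (cmod (coord (x - truncate F x) k))\<^sup>2) = (\<Sum>k\<in>G - F. ?f k)"
      using F(1) that by (intro sum.mono_neutral_cong_right) (auto simp: coord_diff coord_truncate)
    also have "\<dots> = sum ?f (G \<union> F) - sum ?f F"
      using sum_diff[of "G \<union> F" F ?f] F(1) that by (simp add: Un_Diff)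
    also have "sum ?f (G \<union> F) \<le> infsum ?f UNIV"
      using F(1) that by (intro finite_sum_le_infsum s) auto
    also have "infsum ?f UNIV - sum ?f F \<le> (e / 3)\<^sup>2"
      using F(2) by (simp add: dist_real_def)
    finally show ?thesis
      unfolding L2_set_def using assms by (intro real_le_lsqrt) (auto simp: sum_nonneg)
  qed
  from l2_bounded(2)[OF this, of UNIV] have "l2_norm UNIV (coord (x - truncate F x)) \<le> e / 3"
    by simp
  then have "norm (x - truncate F x) < e"
    using norm_le_l2_norm[of "x - truncate F x"] assms by linarith
  then show ?thesis
    using F(1) by blast
qed

text \<open>Bounded sets in the span of finitely many vectors are relatively compact: each
  coefficient runs over a closed disc, and sums of compact sets are compact.\<close>

lemma compact_superset_sums:
  fixes v :: "'i \<Rightarrow> 'a :: complex_normed_vector"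
  assumes "finite F"
  shows "\<exists>C. compact C \<and> (\<forall>c. (\<forall>k\<in>F. cmod (c k) \<le> b) \<longrightarrow> (\<Sum>k\<in>F. c k *\<^sub>C v k) \<in> C)"
  using assms
proof induction
  case empty
  show ?case
    by (rule exI[of _ "{0}"]) simp
next
  case (insert i F)
  then obtain C where C: "compact C"
    "\<And>c. \<forall>k\<in>F. cmod (c k) \<le> b \<Longrightarrow> (\<Sum>k\<in>F. c k *\<^sub>C v k) \<in> C"
    by blast
  let ?C = "{x + y |x y. x \<in> (\<lambda>c. c *\<^sub>C v i) ` cball 0 b \<and> y \<in> C}"
  have "compact ?C"
    by (intro compact_sums C(1) compact_continuous_image compact_cball
        bounded_linear.continuous_on[OF bounded_linear_scaleC_left] continuous_intros)
  moreover have "(\<Sum>k\<in>insert i F. c k *\<^sub>C v k) \<in> ?C" if "\<forall>k\<in>insert i F. cmod (c k) \<le> b" for c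
    using insert.hyps that C(2)[of c] by (force simp: dist_norm)
  ultimately show ?case
    by blast
qed

lemma l2_norm_cong: "(\<And>k. k \<in> S \<Longrightarrow> x k = y k) \<Longrightarrow> l2_norm S x = l2_norm S y"
  unfolding l2_norm_def by (intro arg_cong[where f = sqrt] infsum_cong) simp

section \<open>The weighted shift\<close>

text \<open>The decay at infinity gives compactness. The factor \<open>8\<close> makes up for the
  crude constant \<open>4\<close> in \<open>norm_shift_bound\<close>, leaving
  \<open>4 / 8 = 1 / 2\<close> away from the exceptional index \<open>0\<close>.\<close>

definition weight :: "int \<Rightarrow> real" where
  "weight k = (if k = 0 then 1 else 1 / (8 * real_of_int \<bar>k\<bar>))"

lemma weight_pos: "0 < weight k" and weight_le_1: "weight k \<le> 1"
  and weight_le_eighth: "k \<noteq> 0 \<Longrightarrow> weight k \<le> 1 / 8"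
  by (auto simp: weight_def field_simps)

lemma l2_shift_bound:
  assumes x: "square_summable x" and "0 \<le> c"
    and le: "\<And>k :: int. cmod (y (k + 1)) \<le> c * cmod (x k)"
  shows "square_summable y" "l2_norm S y \<le> c * l2_norm UNIV x"
proof -
  have *: "L2_set (\<lambda>k. cmod (y k)) F \<le> c * l2_norm UNIV x" if "finite F" for F
  proof -
    have "L2_set (\<lambda>k. cmod (y k)) F \<le> L2_set (\<lambda>k. c * cmod (x (k - 1))) F"
      using le[of "_ - 1"] by (intro L2_set_mono) auto
    also have "\<dots> = c * L2_set (\<lambda>k. cmod (x (k - 1))) F"
      by (rule L2_set_right_distrib[OF \<open>0 \<le> c\<close>, symmetric])
    also have "L2_set (\<lambda>k. cmod (x (k - 1))) F = L2_set (\<lambda>k. cmod (x k)) ((\<lambda>k. k - 1) ` F)"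
      by (simp add: L2_set_def sum.reindex inj_on_def)
    also have "\<dots> \<le> l2_norm UNIV x"
      using that by (intro L2_set_le_l2_norm x) auto
    finally show ?thesis
      using \<open>0 \<le> c\<close> by (simp add: mult_left_mono)
  qed
  show "square_summable y" "l2_norm S y \<le> c * l2_norm UNIV x"
    by (rule l2_bounded[OF *]; assumption)+
qed

text \<open>The constant \<open>4\<close> is the product of the factors \<open>2\<close> in the two
  comparisons with the usual norm.\<close>

lemma norm_shift_bound:
  assumes "0 \<le> c" "\<And>k. cmod (coord y (k + 1)) \<le> c * cmod (coord x k)"
  shows "norm y \<le> 4 * c * norm x"
proof -
  have "norm y \<le> 2 * l2_norm UNIV (coord y)"
    by (rule norm_le_l2_norm)
  also have "\<dots> \<le> 2 * (c * l2_norm UNIV (coord x))"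
    using l2_shift_bound(2)[OF square_summable_coord assms] by simp
  also have "\<dots> \<le> 2 * (c * (2 * norm x))"
    using assms(1) l2_norm_le_norm by (intro mult_left_mono) auto
  finally show ?thesis
    by simp
qed

lift_definition wshift :: "ell2_star \<Rightarrow> ell2_star"
  is "\<lambda>x k. of_real (weight (k - 1)) * x (k - 1)"
  by (rule l2_shift_bound(1)[where c = 1])
    (auto simp: norm_mult weight_le_1 less_imp_le[OF weight_pos] intro!: mult_left_le_one_le)

lemma coord_wshift: "coord (wshift x) k = of_real (weight (k - 1)) * coord x (k - 1)"
  by (simp add: wshift.rep_eq)

lemma cmod_coord_wshift: "cmod (coord (wshift x) (k + 1)) = weight k * cmod (coord x k)"
  using weight_pos[of k] by (simp add: coord_wshift norm_mult)

lemma norm_wshift_le: "norm (wshift x) \<le> 4 * norm x"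
  using norm_shift_bound[of 1 "wshift x" x] weight_le_1
  by (simp add: cmod_coord_wshift mult_right_mono weight_le_1 mult_left_le_one_le
      less_imp_le[OF weight_pos])

text \<open>The only weight above \<open>1 / 8\<close> is the one at \<open>0\<close>, and it
  multiplies a vanishing coordinate.\<close>

lemma norm_wshift_le_half:
  assumes "coord x 0 = 0"
  shows "norm (wshift x) \<le> norm x / 2"
proof -
  have "norm (wshift x) \<le> 4 * (1 / 8) * norm x"
  proof (rule norm_shift_bound)
    show "cmod (coord (wshift x) (k + 1)) \<le> 1 / 8 * cmod (coord x k)" for k
      unfolding cmod_coord_wshift using assms weight_le_eighth[of k]
      by (cases "k = 0") (auto intro: mult_right_mono simp del: times_divide_eq_left)
  qed simp
  then show ?thesis
    by simp
qed

lemma wshift_add: "wshift (x + y) = wshift x + wshift y"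
  by (rule ell2_star_eqI) (simp add: coord_wshift coord_add algebra_simps)

lemma wshift_scaleC: "wshift (c *\<^sub>C x) = c *\<^sub>C wshift x"
  by (rule ell2_star_eqI) (simp add: coord_wshift coord_scaleC)

lemma bounded_linear_wshift: "bounded_linear wshift"
  by (rule bounded_linear_intro[where K = 4])
    (use norm_wshift_le in \<open>auto simp: wshift_add wshift_scaleC scaleR_scaleC mult.commute\<close>)

lemma inj_wshift: "inj wshift"
proof (rule injI, rule ell2_star_eqI)
  fix x y k assume "wshift x = wshift y"
  then have "coord (wshift x) (k + 1) = coord (wshift y) (k + 1)"
    by simp
  then show "coord x k = coord y k"
    using weight_pos[of k] by (simp add: coord_wshift)
qed

text \<open>Since the weights tend to \<open>0\<close>, finite rank truncations approximate the
  shift in operator norm.\<close>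

lemma wshift_truncate_approx:
  assumes "e > 0"
  shows "\<exists>F. finite F \<and> (\<forall>x. norm (wshift x - truncate F (wshift x)) \<le> e * norm x)"
proof (intro exI conjI allI)
  let ?N = "\<lceil>1 / e\<rceil>"
  \<comment> \<open>The window is centred at \<open>1\<close> because coordinate
    \<open>k + 1\<close> of the image comes from coordinate \<open>k\<close>; outside it,
    \<open>\<bar>k\<bar>\<close> exceeds \<open>1 / e\<close>.\<close>
  let ?F = "{- ?N..?N + 2}"
  show "finite ?F"
    by simp
  have N: "0 < ?N"
    using assms by simp
  fix x
  have "norm (wshift x - truncate ?F (wshift x)) \<le> 4 * (e / 4) * norm x"
  proof (rule norm_shift_bound)
    fix k
    show "cmod (coord (wshift x - truncate ?F (wshift x)) (k + 1)) \<le> e / 4 * cmod (coord x k)"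
    proof (cases "k + 1 \<in> ?F")
      case False
      then have "?N + 1 \<le> \<bar>k\<bar>"
        by auto
      then have "1 / e < real_of_int \<bar>k\<bar>"
        by linarith
      moreover have "k \<noteq> 0"
        using \<open>?N + 1 \<le> \<bar>k\<bar>\<close> N by linarith
      ultimately have "weight k \<le> e / 4"
        using assms by (simp add: weight_def field_simps)
      then show ?thesis
        using False by (simp add: coord_diff coord_truncate cmod_coord_wshift mult_right_mono
            del: atLeastAtMost_iff times_divide_eq_left)
    qed (use assms in \<open>simp add: coord_diff coord_truncate del: atLeastAtMost_iff\<close>)
  qed (use assms in simp)
  then show "norm (wshift x - truncate ?F (wshift x)) \<le> e * norm x"
    by simp
qed

lemma compact_operator_wshift: "compact_operator wshift"
  unfolding compact_operator_def
proof (intro conjI allI impI bounded_linear_wshift wshift_scaleC)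
  fix S :: "ell2_star set" assume "bounded S"
  then obtain b where b: "b > 0" "\<And>x. x \<in> S \<Longrightarrow> norm x \<le> b"
    by (auto simp: bounded_pos)
  show "compact (closure (wshift ` S))"
  proof (rule compact_closure_if_approx)
    fix e :: real assume "e > 0"
    \<comment> \<open>On vectors of norm at most \<open>b\<close> the truncation error is then at
      most \<open>e / 2\<close>.\<close>
    then obtain F where F: "finite F"
      "\<And>x. norm (wshift x - truncate F (wshift x)) \<le> e / (2 * b) * norm x"
      using wshift_truncate_approx[of "e / (2 * b)"] b(1) by auto
    obtain C where C: "compact C"
      "\<And>c. \<forall>k\<in>F. cmod (c k) \<le> 4 * b \<Longrightarrow> (\<Sum>k\<in>F. c k *\<^sub>C unit_vec k) \<in> C"
      using compact_superset_sums[OF F(1)] by blast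
    have "truncate F (wshift x) \<in> C \<and> dist (wshift x) (truncate F (wshift x)) < e"
      if "x \<in> S" for x
    proof
      have "cmod (coord (wshift x) k) \<le> 4 * b" for k
        using cmod_coord_le_norm[of "wshift x" k] norm_wshift_le[of x] b(2)[OF that] by linarith
      then show "truncate F (wshift x) \<in> C"
        unfolding truncate_def by (intro C(2)) simp
      have "norm (wshift x - truncate F (wshift x)) \<le> e / (2 * b) * norm x"
        by (rule F(2))
      also have "\<dots> \<le> e / (2 * b) * b"
        using b(1) b(2)[OF that] \<open>e > 0\<close> by (intro mult_left_mono) auto
      also have "\<dots> < e"
        using b(1) \<open>e > 0\<close> by simp
      finally show "dist (wshift x) (truncate F (wshift x)) < e"
        by (simp add: dist_norm)
    qed
    with C(1) show "\<exists>C. compact C \<and> (\<forall>x\<in>wshift ` S. \<exists>y\<in>C. dist x y < e)"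
      by blast
  qed
qed

interpretation wshift: compact_inverse wshift
  by unfold_locales (rule compact_operator_wshift inj_wshift)+

text \<open>No weight vanishes, so every finitely supported vector has a preimage, found by dividing
  by the weights and shifting back. Such vectors are dense by
  \<open>truncate_approx\<close>.\<close>

lemma densely_defined_range_wshift: "densely_defined (range wshift)"
  unfolding densely_defined_def
proof (intro equalityI subset_UNIV subsetI)
  fix x :: ell2_star
  have truncate: "truncate F x \<in> range wshift" if "finite F" for F
  proof
    let ?y = "\<Sum>k\<in>F. (coord x k / of_real (weight (k - 1))) *\<^sub>C unit_vec (k - 1)"
    have "coord (wshift ?y) k = coord (truncate F x) k" for k
      using that weight_pos[of "k - 1"]
      by (simp add: coord_wshift coord_truncate coord_sum coord_scaleC coord_unit_vec
          if_distrib cong: if_cong)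
    then show "truncate F x = wshift ?y"
      by (metis ell2_star_eqI)
  qed simp
  show "x \<in> closure (range wshift)"
    unfolding closure_approachable
  proof (intro allI impI)
    fix e :: real assume "e > 0"
    then obtain F where "finite F" "norm (x - truncate F x) < e"
      using truncate_approx by blast
    then show "\<exists>y\<in>range wshift. dist y x < e"
      using truncate by (intro bexI[of _ "truncate F x"]) (auto simp: dist_norm norm_minus_commute)
  qed
qed

section \<open>The resolvent norm\<close>

text \<open>The shift is bilateral, so the support of \<open>z\<close> has to be established. At
  negative indices \<open>unit_vec 0\<close> contributes nothing, and each coordinate is at most
  half its left neighbour. Going \<open>n\<close> steps left bounds it by
  \<open>norm z / 2 ^ n\<close> for every \<open>n\<close>.\<close>

lemma coord_solution_neg:
  assumes z: "z = unit_vec 0 + l *\<^sub>C wshift z" and l: "cmod l \<le> 1 / 2" and "k < 0"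
  shows "coord z k = 0"
proof -
  have step: "cmod (coord z (k + 1)) \<le> 1 / 2 * cmod (coord z k)" if "k + 1 < 0" for k
  proof -
    have "cmod (coord z (k + 1)) = cmod l * weight k * cmod (coord z k)"
      using that arg_cong[OF z, of "\<lambda>z. cmod (coord z (k + 1))"]
      by (simp add: coord_add coord_scaleC coord_unit_vec norm_mult cmod_coord_wshift)
    also have "\<dots> \<le> 1 / 2 * 1 * cmod (coord z k)"
      using l weight_le_1[of k] weight_pos[of k] by (intro mult_right_mono mult_mono) auto
    finally show ?thesis
      by simp
  qed
  have bound: "cmod (coord z k) \<le> (1 / 2) ^ n * norm z" if "k < 0" for k n
    using that
  proof (induction n arbitrary: k)
    case 0
    then show ?case
      by (simp add: cmod_coord_le_norm)
  next
    case (Suc n)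
    show ?case
      using step[of "k - 1"] Suc.IH[of "k - 1"] Suc.prems by simp
  qed
  have "(\<lambda>n. (1 / 2) ^ n * norm z) \<longlonglongrightarrow> 0 * norm z"
    by (intro tendsto_intros) simp
  then have "cmod (coord z k) \<le> 0"
    using bound[OF \<open>k < 0\<close>] by (intro LIMSEQ_le_const[where X = "\<lambda>n. (1 / 2) ^ n * norm z"]) auto
  then show ?thesis
    by simp
qed

context
  fixes l :: complex
  assumes l: "cmod l < 1 / 64"
begin

abbreviation "R \<equiv> resolvent (range wshift) (inv wshift) l"

lemma mult_4_le_half: "cmod l * 4 \<le> 1 / 2"
  using l by simp

lemmas small_in_resolvent_set = wshift.in_resolvent_set[OF norm_wshift_le mult_4_le_half]
lemmas bij_id_minus_wshift = wshift.bij_id_minus[OF norm_wshift_le mult_4_le_half]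
lemmas solution_le = wshift.norm_solution_le[OF norm_wshift_le mult_4_le_half]

text \<open>The third property controls the remainder \<open>R y - wshift y\<close>, which equals
  \<open>l *\<^sub>C wshift (wshift z)\<close>.\<close>

lemma obtain_solution:
  obtains z where "z = y + l *\<^sub>C wshift z" "R y = wshift z"
    "norm (l *\<^sub>C wshift (wshift z)) \<le> norm y / 2"
proof -
  let ?z = "y + l *\<^sub>C R y"
  have R: "R y = wshift ?z"
    by (rule wshift.resolvent_fixed_point[OF bij_id_minus_wshift])
  then have z: "?z = y + l *\<^sub>C wshift ?z"
    by simp
  have le: "norm ?z \<le> 2 * norm y"
    by (rule solution_le[OF z])
  \<comment> \<open>The radius \<open>1 / 64\<close> is chosen here: two shifts cost
    \<open>4 * 4\<close>, the solution costs \<open>2\<close>, and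
    \<open>32 / 64 = 1 / 2\<close>.\<close>
  have "norm (l *\<^sub>C wshift (wshift ?z)) \<le> 1 / 64 * norm (wshift (wshift ?z))"
    unfolding norm_scaleC using l by (intro mult_right_mono) auto
  then have "norm (l *\<^sub>C wshift (wshift ?z)) \<le> norm y / 2"
    using norm_wshift_le[of "wshift ?z"] norm_wshift_le[of ?z] le by linarith
  with z R that show thesis
    by blast
qed

text \<open>Both \<open>wshift y\<close> and the remainder have norm at most
  \<open>norm y / 2\<close>.\<close>

lemma norm_resolvent_le:
  assumes "coord y 0 = 0"
  shows "norm (R y) \<le> norm y"
proof -
  obtain z where z: "z = y + l *\<^sub>C wshift z" "R y = wshift z"
    "norm (l *\<^sub>C wshift (wshift z)) \<le> norm y / 2"
    by (rule obtain_solution)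
  have "R y = wshift y + l *\<^sub>C wshift (wshift z)"
    using z(1,2) by (metis wshift_add wshift_scaleC)
  then show ?thesis
    using norm_triangle_ineq[of "wshift y" "l *\<^sub>C wshift (wshift z)"] z(3)
      norm_wshift_le_half[OF assms] by simp
qed

lemma norm_unit_vec_0: "norm (unit_vec 0) = 1"
proof -
  have "l2_norm (UNIV - {0, 1}) (coord (unit_vec 0)) = l2_norm (UNIV - {0, 1 :: int}) (\<lambda>_. 0)"
    by (rule l2_norm_cong) (auto simp: coord_unit_vec)
  then show ?thesis
    by (simp add: norm_ell2_star_def coord_unit_vec l2_norm_zero)
qed

text \<open>Coordinate \<open>0\<close> of the image vanishes and coordinate \<open>1\<close> is
  exactly \<open>1\<close>, whatever \<open>l\<close> is. The dependence on \<open>l\<close> sits in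
  the other coordinates, whose \<open>l2_norm\<close> is too small to affect the maximum.\<close>

lemma norm_resolvent_unit_vec_0: "norm (R (unit_vec 0)) = 1"
proof -
  let ?S = "UNIV - {0, 1} :: int set"
  obtain z where z: "z = unit_vec 0 + l *\<^sub>C wshift z" "R (unit_vec 0) = wshift z"
    "norm (l *\<^sub>C wshift (wshift z)) \<le> norm (unit_vec 0) / 2"
    by (rule obtain_solution)
  have neg: "coord z (- 1) = 0"
    using coord_solution_neg[OF z(1)] l by simp
  then have 0: "coord (wshift z) 0 = 0"
    by (simp add: coord_wshift)
  have "coord z 0 = 1"
    using arg_cong[OF z(1), of "\<lambda>z. coord z 0"] 0
    by (simp add: coord_add coord_scaleC coord_unit_vec)
  then have 1: "coord (wshift z) 1 = 1"
    by (simp add: coord_wshift weight_def)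
  \<comment> \<open>For \<open>k \<noteq> 1\<close> the index \<open>k - 1\<close> is not
    \<open>0\<close>, so the term \<open>unit_vec 0\<close> in the equation for \<open>z\<close>
    drops out.\<close>
  have "coord (wshift z) k = coord (l *\<^sub>C wshift (wshift z)) k" if "k \<in> ?S" for k
    using that arg_cong[OF z(1), of "\<lambda>z. coord z (k - 1)"]
    by (simp add: coord_wshift[of _ k] coord_add coord_scaleC coord_unit_vec)
  then have "l2_norm ?S (coord (wshift z)) = l2_norm ?S (coord (l *\<^sub>C wshift (wshift z)))"
    by (rule l2_norm_cong)
  also have "\<dots> \<le> 1"
    using z(3) norm_ell2_star_ge(1)[of "l *\<^sub>C wshift (wshift z)"]
      norm_ge_zero[of "coord (l *\<^sub>C wshift (wshift z)) 0"]
    unfolding norm_unit_vec_0 by linarith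
  finally show ?thesis
    by (simp add: z(2) norm_ell2_star_def 0 1)
qed

lemma onorm_resolvent: "onorm R = 1"
proof (rule antisym)
  show "onorm R \<le> 1"
  proof (rule onorm_bound)
    fix x
    let ?c = "coord x 0" and ?y = "x - coord x 0 *\<^sub>C unit_vec 0"
    have "l2_norm (UNIV - {0, 1}) (coord ?y) = l2_norm (UNIV - {0, 1}) (coord x)"
      by (rule l2_norm_cong) (auto simp: coord_diff coord_scaleC coord_unit_vec)
    \<comment> \<open>Additivity of the norm in this splitting lets the bounds on
      \<open>unit_vec 0\<close> and on \<open>?y\<close> combine without loss.\<close>
    then have norm: "norm x = cmod ?c + norm ?y"
      by (simp add: norm_ell2_star_def coord_diff coord_scaleC coord_unit_vec)
    have "R (?c *\<^sub>C unit_vec 0 + ?y) = ?c *\<^sub>C R (unit_vec 0) + R ?y"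
      by (simp only: wshift.resolvent_add[OF bij_id_minus_wshift]
          wshift.resolvent_scaleC[OF bij_id_minus_wshift])
    then have "R x = ?c *\<^sub>C R (unit_vec 0) + R ?y"
      by simp
    then have "norm (R x) \<le> cmod ?c * norm (R (unit_vec 0)) + norm (R ?y)"
      by (metis norm_triangle_ineq norm_scaleC)
    moreover have "norm (R ?y) \<le> norm ?y"
      by (rule norm_resolvent_le) (simp add: coord_diff coord_scaleC coord_unit_vec)
    ultimately show "norm (R x) \<le> 1 * norm x"
      by (simp add: norm norm_resolvent_unit_vec_0)
  qed simp
  have "bounded_linear R"
    using small_in_resolvent_set by (simp add: resolvent_set_def)
  \<comment> \<open>The norm is attained at \<open>unit_vec 0\<close>.\<close>
  from onorm[OF this, of "unit_vec 0"] show "1 \<le> onorm R"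
    by (simp add: norm_resolvent_unit_vec_0 norm_unit_vec_0)
qed

end

theorem theorem2p3:
  shows "\<exists>(D :: ell2_star set) (A :: ell2_star \<Rightarrow> ell2_star).
    closed_operator D A \<and> densely_defined D \<and> has_compact_resolvent D A \<and>
    (\<exists>U. open U \<and> 0 \<in> U \<and> U \<subseteq> resolvent_set D A \<and>
         (\<lambda>l. onorm (resolvent D A l)) constant_on U)"
proof (intro exI conjI)
  show "closed_operator (range wshift) (inv wshift)"
    by (rule wshift.closed_operator_inverse)
  show "densely_defined (range wshift)"
    by (rule densely_defined_range_wshift)
  show "has_compact_resolvent (range wshift) (inv wshift)"
    by (rule wshift.has_compact_resolvent_inverse)
  show "open (ball 0 (1 / 64) :: complex set)" "0 \<in> ball (0 :: complex) (1 / 64)"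
    by simp_all
  show "ball 0 (1 / 64) \<subseteq> resolvent_set (range wshift) (inv wshift)"
    by (auto intro: small_in_resolvent_set)
  show "(\<lambda>l. onorm (resolvent (range wshift) (inv wshift) l)) constant_on ball 0 (1 / 64)"
    unfolding constant_on_def by (auto simp: onorm_resolvent)
qed

end
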